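(* Let $n\ge1$ and let $(a_1,a_2,a_3,a_4)\in\mathbb H(\mathbb Z_{2^n})$. Each coordinate $a_i$ is either a unit of $\mathbb Z_{2^n}$ (an odd residue) or a zero-divisor of $\mathbb Z_{2^n}$ (an even residue, including $0$). Consider the five cases: (i) all four coordinates are zero-divisors of $\mathbb Z_{2^n}$; (ii) all four coordinates are units of $\mathbb Z_{2^n}$; (iii) exactly two coordinates are units and two are zero-divisors; (iv) exactly three coordinates are units and one is a zero-divisor; (v) exactly one coordinate is a unit and three are zero-divisors. Every element of $\mathbb H(\mathbb Z_{2^n})$ falls into exactly one of these cases. The elements in cases (i), (ii) and (iii) are zero-divisors of $\mathbb H(\mathbb Z_{2^n})$ (here $(0,0,0,0)$ is counted in case (i)). The elements in cases (iv) and (v) are units of $\mathbb H(\mathbb Z_{2^n})$.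
   Context: $\mathbb H(\mathbb Z_{2^n})$ is the ring of Hamilton quaternions over $\mathbb Z_{2^n}$. Its elements are $a_1+a_2i+a_3j+a_4k$ with $a_i\in\mathbb Z_{2^n}$, written $(a_1,a_2,a_3,a_4)$. Addition is coordinatewise, and multiplication is determined by distributivity, scalars commuting with $i,j,k$, and $i^2=j^2=k^2=-1$, $ij=-ji=k$, $jk=-kj=i$, $ki=-ik=j$. *)

theory Defs
  imports "HOL-Number_Theory.Residues"
begin

type_synonym 'a quat = "'a \<times> 'a \<times> 'a \<times> 'a"

text \<open>
  Hamilton quaternions over a ring \<open>R\<close>: the tuple \<open>(a\<^sub>1, a\<^sub>2, a\<^sub>3, a\<^sub>4)\<close> stands for
  \<open>a\<^sub>1 + a\<^sub>2 i + a\<^sub>3 j + a\<^sub>4 k\<close>.  The product is the bilinear extension of the Hamilton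
  relations, see \<open>quaternion_ring_relations\<close>.
\<close>

fun quat_add :: "('a, 'm) ring_scheme \<Rightarrow> 'a quat \<Rightarrow> 'a quat \<Rightarrow> 'a quat" where
  "quat_add R (a1, a2, a3, a4) (b1, b2, b3, b4) =
     (a1 \<oplus>\<^bsub>R\<^esub> b1, a2 \<oplus>\<^bsub>R\<^esub> b2, a3 \<oplus>\<^bsub>R\<^esub> b3, a4 \<oplus>\<^bsub>R\<^esub> b4)"

fun quat_mult :: "('a, 'm) ring_scheme \<Rightarrow> 'a quat \<Rightarrow> 'a quat \<Rightarrow> 'a quat" where
  "quat_mult R (a1, a2, a3, a4) (b1, b2, b3, b4) =
     (a1 \<otimes>\<^bsub>R\<^esub> b1 \<ominus>\<^bsub>R\<^esub> a2 \<otimes>\<^bsub>R\<^esub> b2 \<ominus>\<^bsub>R\<^esub> a3 \<otimes>\<^bsub>R\<^esub> b3 \<ominus>\<^bsub>R\<^esub> a4 \<otimes>\<^bsub>R\<^esub> b4,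
      a1 \<otimes>\<^bsub>R\<^esub> b2 \<oplus>\<^bsub>R\<^esub> a2 \<otimes>\<^bsub>R\<^esub> b1 \<oplus>\<^bsub>R\<^esub> a3 \<otimes>\<^bsub>R\<^esub> b4 \<ominus>\<^bsub>R\<^esub> a4 \<otimes>\<^bsub>R\<^esub> b3,
      a1 \<otimes>\<^bsub>R\<^esub> b3 \<ominus>\<^bsub>R\<^esub> a2 \<otimes>\<^bsub>R\<^esub> b4 \<oplus>\<^bsub>R\<^esub> a3 \<otimes>\<^bsub>R\<^esub> b1 \<oplus>\<^bsub>R\<^esub> a4 \<otimes>\<^bsub>R\<^esub> b2,
      a1 \<otimes>\<^bsub>R\<^esub> b4 \<oplus>\<^bsub>R\<^esub> a2 \<otimes>\<^bsub>R\<^esub> b3 \<ominus>\<^bsub>R\<^esub> a3 \<otimes>\<^bsub>R\<^esub> b2 \<oplus>\<^bsub>R\<^esub> a4 \<otimes>\<^bsub>R\<^esub> b1)"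

definition quaternion_ring :: "('a, 'm) ring_scheme \<Rightarrow> 'a quat ring" where
  "quaternion_ring R =
     \<lparr>carrier = carrier R \<times> carrier R \<times> carrier R \<times> carrier R,
      monoid.mult = quat_mult R,
      one = (\<one>\<^bsub>R\<^esub>, \<zero>\<^bsub>R\<^esub>, \<zero>\<^bsub>R\<^esub>, \<zero>\<^bsub>R\<^esub>),
      zero = (\<zero>\<^bsub>R\<^esub>, \<zero>\<^bsub>R\<^esub>, \<zero>\<^bsub>R\<^esub>, \<zero>\<^bsub>R\<^esub>),
      add = quat_add R\<rparr>"

lemma quaternion_ring_simps:
  "carrier (quaternion_ring R) = carrier R \<times> carrier R \<times> carrier R \<times> carrier R"
  "x \<otimes>\<^bsub>quaternion_ring R\<^esub> y = quat_mult R x y"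
  "x \<oplus>\<^bsub>quaternion_ring R\<^esub> y = quat_add R x y"
  "\<one>\<^bsub>quaternion_ring R\<^esub> = (\<one>\<^bsub>R\<^esub>, \<zero>\<^bsub>R\<^esub>, \<zero>\<^bsub>R\<^esub>, \<zero>\<^bsub>R\<^esub>)"
  "\<zero>\<^bsub>quaternion_ring R\<^esub> = (\<zero>\<^bsub>R\<^esub>, \<zero>\<^bsub>R\<^esub>, \<zero>\<^bsub>R\<^esub>, \<zero>\<^bsub>R\<^esub>)"
  by (simp_all add: quaternion_ring_def)

lemma (in cring) quat_distr:
  assumes "x \<in> carrier (quaternion_ring R)" "y \<in> carrier (quaternion_ring R)"
    "z \<in> carrier (quaternion_ring R)"
  shows "quat_mult R (quat_add R x y) z = quat_add R (quat_mult R x z) (quat_mult R y z)"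
    "quat_mult R z (quat_add R x y) = quat_add R (quat_mult R z x) (quat_mult R z y)"
  using assms by (auto simp: quaternion_ring_simps minus_eq
      l_distr r_distr l_minus r_minus minus_add a_ac)

lemma (in cring) quat_assoc:
  assumes "x \<in> carrier (quaternion_ring R)" "y \<in> carrier (quaternion_ring R)"
    "z \<in> carrier (quaternion_ring R)"
  shows "quat_mult R (quat_mult R x y) z = quat_mult R x (quat_mult R y z)"
proof -
  obtain a1 a2 a3 a4 b1 b2 b3 b4 c1 c2 c3 c4 where
    e: "x = (a1,a2,a3,a4)" "y = (b1,b2,b3,b4)" "z = (c1,c2,c3,c4)" by (metis prod_cases4)
  have m: "a1 \<in> carrier R" "a2 \<in> carrier R" "a3 \<in> carrier R" "a4 \<in> carrier R"
       "b1 \<in> carrier R" "b2 \<in> carrier R" "b3 \<in> carrier R" "b4 \<in> carrier R"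
       "c1 \<in> carrier R" "c2 \<in> carrier R" "c3 \<in> carrier R" "c4 \<in> carrier R"
    using assms by (auto simp: e quaternion_ring_simps)
  show ?thesis
    unfolding e quat_mult.simps prod.inject using m
    by (intro conjI)
       (simp_all add: minus_eq l_distr r_distr l_minus r_minus minus_add m_assoc a_ac)
qed
lemma (in cring) quaternion_ring_is_ring: "ring (quaternion_ring R)"
proof (rule ringI)
  show "abelian_group (quaternion_ring R)"
  proof (rule abelian_groupI)
    fix x assume "x \<in> carrier (quaternion_ring R)"
    then obtain a b c d where x: "x = (a, b, c, d)"
      and "a \<in> carrier R" "b \<in> carrier R" "c \<in> carrier R" "d \<in> carrier R"
      by (auto simp: quaternion_ring_simps)
    then show "\<exists>y\<in>carrier (quaternion_ring R).
        y \<oplus>\<^bsub>quaternion_ring R\<^esub> x = \<zero>\<^bsub>quaternion_ring R\<^esub>"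
      by (intro bexI[of _ "(\<ominus> a, \<ominus> b, \<ominus> c, \<ominus> d)"])
         (auto simp: quaternion_ring_simps l_neg)
  qed (auto simp: quaternion_ring_simps a_ac)
  show "Group.monoid (quaternion_ring R)"
  proof (rule monoidI)
    fix x y z
    assume "x \<in> carrier (quaternion_ring R)" "y \<in> carrier (quaternion_ring R)"
      "z \<in> carrier (quaternion_ring R)"
    then show "x \<otimes>\<^bsub>quaternion_ring R\<^esub> y \<otimes>\<^bsub>quaternion_ring R\<^esub> z =
        x \<otimes>\<^bsub>quaternion_ring R\<^esub> (y \<otimes>\<^bsub>quaternion_ring R\<^esub> z)"
      using quat_assoc by (simp add: quaternion_ring_simps)
  qed (auto simp: quaternion_ring_simps minus_eq)
next
  fix x y z
  assume "x \<in> carrier (quaternion_ring R)" "y \<in> carrier (quaternion_ring R)"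
    "z \<in> carrier (quaternion_ring R)"
  then show "(x \<oplus>\<^bsub>quaternion_ring R\<^esub> y) \<otimes>\<^bsub>quaternion_ring R\<^esub> z =
      x \<otimes>\<^bsub>quaternion_ring R\<^esub> z \<oplus>\<^bsub>quaternion_ring R\<^esub> y \<otimes>\<^bsub>quaternion_ring R\<^esub> z"
    and "z \<otimes>\<^bsub>quaternion_ring R\<^esub> (x \<oplus>\<^bsub>quaternion_ring R\<^esub> y) =
      z \<otimes>\<^bsub>quaternion_ring R\<^esub> x \<oplus>\<^bsub>quaternion_ring R\<^esub> z \<otimes>\<^bsub>quaternion_ring R\<^esub> y"
    using quat_distr[of x y z] by (auto simp only: quaternion_ring_simps(2,3))
qed

lemma (in cring) quaternion_ring_relations:
  defines "H \<equiv> quaternion_ring R"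
    and "qi \<equiv> (\<zero>, \<one>, \<zero>, \<zero>)" and "qj \<equiv> (\<zero>, \<zero>, \<one>, \<zero>)" and "qk \<equiv> (\<zero>, \<zero>, \<zero>, \<one>)"
    and "scal \<equiv> \<lambda>a. (a, \<zero>, \<zero>, \<zero>)"
  shows "qi \<otimes>\<^bsub>H\<^esub> qi \<oplus>\<^bsub>H\<^esub> \<one>\<^bsub>H\<^esub> = \<zero>\<^bsub>H\<^esub>" "qj \<otimes>\<^bsub>H\<^esub> qj \<oplus>\<^bsub>H\<^esub> \<one>\<^bsub>H\<^esub> = \<zero>\<^bsub>H\<^esub>"
    "qk \<otimes>\<^bsub>H\<^esub> qk \<oplus>\<^bsub>H\<^esub> \<one>\<^bsub>H\<^esub> = \<zero>\<^bsub>H\<^esub>"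
    "qi \<otimes>\<^bsub>H\<^esub> qj = qk" "qj \<otimes>\<^bsub>H\<^esub> qi \<oplus>\<^bsub>H\<^esub> qk = \<zero>\<^bsub>H\<^esub>"
    "qj \<otimes>\<^bsub>H\<^esub> qk = qi" "qk \<otimes>\<^bsub>H\<^esub> qj \<oplus>\<^bsub>H\<^esub> qi = \<zero>\<^bsub>H\<^esub>"
    "qk \<otimes>\<^bsub>H\<^esub> qi = qj" "qi \<otimes>\<^bsub>H\<^esub> qk \<oplus>\<^bsub>H\<^esub> qj = \<zero>\<^bsub>H\<^esub>"
    "\<And>a x. a \<in> carrier R \<Longrightarrow> x \<in> {qi, qj, qk} \<Longrightarrow> scal a \<otimes>\<^bsub>H\<^esub> x = x \<otimes>\<^bsub>H\<^esub> scal a"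
    "\<And>a b c d. a \<in> carrier R \<Longrightarrow> b \<in> carrier R \<Longrightarrow> c \<in> carrier R \<Longrightarrow> d \<in> carrier R \<Longrightarrow>
       (a, b, c, d) = scal a \<oplus>\<^bsub>H\<^esub> scal b \<otimes>\<^bsub>H\<^esub> qi \<oplus>\<^bsub>H\<^esub> scal c \<otimes>\<^bsub>H\<^esub> qj \<oplus>\<^bsub>H\<^esub> scal d \<otimes>\<^bsub>H\<^esub> qk"
  unfolding assms by (auto simp: quaternion_ring_simps minus_eq l_neg)

text \<open>
  Left or right zero-divisors; \<open>\<zero>\<close> is a zero-divisor of every nontrivial ring.  In a finite ring
  the left/right distinction is immaterial, see \<open>zero_divisor_iff_two_sided\<close>.
\<close>

definition zero_divisor :: "('a, 'm) ring_scheme \<Rightarrow> 'a \<Rightarrow> bool" where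
  "zero_divisor R a \<longleftrightarrow> a \<in> carrier R \<and>
     (\<exists>b\<in>carrier R. b \<noteq> \<zero>\<^bsub>R\<^esub> \<and> (a \<otimes>\<^bsub>R\<^esub> b = \<zero>\<^bsub>R\<^esub> \<or> b \<otimes>\<^bsub>R\<^esub> a = \<zero>\<^bsub>R\<^esub>))"

lemma (in ring) zero_divisor_iff_two_sided:
  assumes fin: "finite (carrier R)"
  shows "zero_divisor R a \<longleftrightarrow> a \<in> carrier R \<and>
     (\<exists>b\<in>carrier R. b \<noteq> \<zero> \<and> a \<otimes> b = \<zero>) \<and> (\<exists>b\<in>carrier R. b \<noteq> \<zero> \<and> b \<otimes> a = \<zero>)"
proof -
  have right: "\<exists>c\<in>carrier R. c \<noteq> \<zero> \<and> c \<otimes> a = \<zero>"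
    if a: "a \<in> carrier R" and b: "b \<in> carrier R" "b \<noteq> \<zero>" "a \<otimes> b = \<zero>" for b
  proof (rule ccontr)
    assume none: "\<not> ?thesis"
    have "inj_on (\<lambda>x. x \<otimes> a) (carrier R)"
    proof (rule inj_onI)
      fix x y assume xy: "x \<in> carrier R" "y \<in> carrier R" "x \<otimes> a = y \<otimes> a"
      then have "(x \<ominus> y) \<otimes> a = \<zero>" using a by algebra
      then have "x \<ominus> y = \<zero>" using none xy by blast
      then show "x = y" using xy by simp
    qed
    then have "(\<lambda>x. x \<otimes> a) ` carrier R = carrier R"
      using fin a by (intro endo_inj_surj) auto
    then obtain c where c: "c \<in> carrier R" "c \<otimes> a = \<one>" by (metis imageE one_closed)
    have "b = (c \<otimes> a) \<otimes> b" using b c by simp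
    also have "\<dots> = c \<otimes> (a \<otimes> b)" using a b c by (intro m_assoc)
    also have "\<dots> = \<zero>" using b c by simp
    finally show False using b by simp
  qed
  have left: "\<exists>c\<in>carrier R. c \<noteq> \<zero> \<and> a \<otimes> c = \<zero>"
    if a: "a \<in> carrier R" and b: "b \<in> carrier R" "b \<noteq> \<zero>" "b \<otimes> a = \<zero>" for b
  proof (rule ccontr)
    assume none: "\<not> ?thesis"
    have "inj_on (\<lambda>x. a \<otimes> x) (carrier R)"
    proof (rule inj_onI)
      fix x y assume xy: "x \<in> carrier R" "y \<in> carrier R" "a \<otimes> x = a \<otimes> y"
      then have "a \<otimes> (x \<ominus> y) = \<zero>" using a by algebra
      then have "x \<ominus> y = \<zero>" using none xy by blast
      then show "x = y" using xy by simp
    qed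
    then have "(\<lambda>x. a \<otimes> x) ` carrier R = carrier R"
      using fin a by (intro endo_inj_surj) auto
    then obtain c where c: "c \<in> carrier R" "a \<otimes> c = \<one>" by (metis imageE one_closed)
    have "b = b \<otimes> (a \<otimes> c)" using b c by simp
    also have "\<dots> = (b \<otimes> a) \<otimes> c" using a b c by (intro m_assoc[symmetric])
    also have "\<dots> = \<zero>" using b c by simp
    finally show False using b by simp
  qed
  show ?thesis unfolding zero_divisor_def using left right by blast
qed

fun coords :: "'a quat \<Rightarrow> 'a list" where
  "coords (a1, a2, a3, a4) = [a1, a2, a3, a4]"

definition num_units :: "('a, 'm) ring_scheme \<Rightarrow> 'a quat \<Rightarrow> nat" where
  "num_units R x = length (filter (\<lambda>a. a \<in> Units R) (coords x))"

definition num_zero_divisors :: "('a, 'm) ring_scheme \<Rightarrow> 'a quat \<Rightarrow> nat" where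
  "num_zero_divisors R x = length (filter (zero_divisor R) (coords x))"

datatype quat_case = Case_i | Case_ii | Case_iii | Case_iv | Case_v

fun in_case :: "('a, 'm) ring_scheme \<Rightarrow> 'a quat \<Rightarrow> quat_case \<Rightarrow> bool" where
  "in_case R x Case_i \<longleftrightarrow> (\<forall>a\<in>set (coords x). zero_divisor R a)"
| "in_case R x Case_ii \<longleftrightarrow> (\<forall>a\<in>set (coords x). a \<in> Units R)"
| "in_case R x Case_iii \<longleftrightarrow> num_units R x = 2 \<and> num_zero_divisors R x = 2"
| "in_case R x Case_iv \<longleftrightarrow> num_units R x = 3 \<and> num_zero_divisors R x = 1"
| "in_case R x Case_v \<longleftrightarrow> num_units R x = 1 \<and> num_zero_divisors R x = 3"

end

theory Submission
  imports Defs
begin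

text \<open>
  Modulo \<open>2\<close> the norm \<open>N = a\<^sub>1\<^sup>2 + a\<^sub>2\<^sup>2 + a\<^sub>3\<^sup>2 + a\<^sub>4\<^sup>2\<close> is the number of odd coordinates.  If this number
  is odd then \<open>N\<close> is a unit and the conjugate divided by \<open>N\<close> is an inverse.  If it is even then
  every signed sum \<open>\<plusminus>a\<^sub>1 \<plusminus> a\<^sub>2 \<plusminus> a\<^sub>3 \<plusminus> a\<^sub>4\<close> is even, so \<open>2\<^sup>n\<^sup>-\<^sup>1 (1 + i + j + k)\<close> annihilates the quaternion.
\<close>

context residues
begin

text \<open>Moves the product to plain integer polynomials with a single reduction per coordinate,
  so that later identities are integer algebra.\<close>

lemma quat_mult_residue_ring:
  "quat_mult R (a1, a2, a3, a4) (b1, b2, b3, b4) =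
     ((a1 * b1 - a2 * b2 - a3 * b3 - a4 * b4) mod m,
      (a1 * b2 + a2 * b1 + a3 * b4 - a4 * b3) mod m,
      (a1 * b3 - a2 * b4 + a3 * b1 + a4 * b2) mod m,
      (a1 * b4 + a2 * b3 - a3 * b2 + a4 * b1) mod m)"
proof -
  have sub: "x \<ominus> y mod m = (x - y) mod m" for x y
    by (simp add: a_minus_def res_add_eq res_neg_eq mod_simps)
  show ?thesis
    by (simp add: sub res_add_eq res_mult_eq mod_simps)
qed

text \<open>Reduction of the factors is absorbed by the final reduction. This lets the inverse be
  written with reduced coordinates, as the carrier demands, yet multiplied without them.\<close>

lemma quat_mult_mod:
  "quat_mult R (a1 mod m, a2 mod m, a3 mod m, a4 mod m) y = quat_mult R (a1, a2, a3, a4) y"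
  "quat_mult R y (a1 mod m, a2 mod m, a3 mod m, a4 mod m) = quat_mult R y (a1, a2, a3, a4)"
  by (cases y; simp only: quat_mult_residue_ring prod.inject flip: cong_def;
      intro conjI cong_add cong_diff cong_mult; simp)+

lemma quat_unit_if_coprime_norm:
  assumes x: "(a1, a2, a3, a4) \<in> carrier (quaternion_ring R)"
    and cop: "coprime (a1\<^sup>2 + a2\<^sup>2 + a3\<^sup>2 + a4\<^sup>2) m"
  shows "(a1, a2, a3, a4) \<in> Units (quaternion_ring R)"
proof -
  obtain c where "[(a1\<^sup>2 + a2\<^sup>2 + a3\<^sup>2 + a4\<^sup>2) * c = 1] (mod m)"
    using cop cong_solve_coprime_int by blast
  then have c: "((a1\<^sup>2 + a2\<^sup>2 + a3\<^sup>2 + a4\<^sup>2) * c) mod m = 1"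
    using m_gt_one by (simp add: cong_def)
  let ?x = "(a1, a2, a3, a4)"
  \<comment> \<open>The conjugate times \<open>c\<close>, the inverse of the norm modulo
    \<open>m\<close>.\<close>
  let ?y = "((a1 * c) mod m, (- a2 * c) mod m, (- a3 * c) mod m, (- a4 * c) mod m)"
  have "?y \<in> carrier (quaternion_ring R)"
    using m_gt_one by (simp add: quaternion_ring_simps res_carrier_eq)
  moreover have "quat_mult R ?x ?y = (\<one>, \<zero>, \<zero>, \<zero>)" "quat_mult R ?y ?x = (\<one>, \<zero>, \<zero>, \<zero>)"
    unfolding quat_mult_mod
    \<comment> \<open>Rewriting 1 as norm times \<open>c\<close> modulo \<open>m\<close> turns each
      coordinate into a polynomial identity.\<close>
    unfolding quat_mult_residue_ring res_zero_eq res_one_eq c[symmetric]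
    by (simp_all add: algebra_simps power2_eq_square)
  ultimately show ?thesis
    using x by (auto simp: Units_def quaternion_ring_simps)
qed

end

lemma residues_two_power: "n \<ge> 1 \<Longrightarrow> residues (2 ^ n)"
  by (simp add: residues_def)

lemma units_residue_ring_two_power:
  assumes "n \<ge> 1" "a \<in> carrier (residue_ring (2 ^ n))"
  shows "a \<in> Units (residue_ring (2 ^ n)) \<longleftrightarrow> odd a"
proof -
  interpret residues "2 ^ n" "residue_ring (2 ^ n)"
    using residues_two_power[OF assms(1)] by simp_all
  have "a \<in> Units (residue_ring (2 ^ n)) \<longleftrightarrow> coprime a (2 ^ n)"
    \<comment> \<open>\<open>res_units_eq\<close> asks for a positive residue; 0 is not coprime to
      \<open>2 ^ n\<close> because n \<ge> 1.\<close>
    using assms by (auto simp: res_units_eq res_carrier_eq le_less)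
  then show ?thesis
    using assms(1) by simp
qed

text \<open>An odd \<open>a\<close> is coprime to \<open>2 ^ n\<close> and so can be cancelled; an
  even \<open>a\<close> is annihilated by the nonzero residue \<open>2 ^ (n - 1)\<close>.\<close>

lemma zero_divisor_residue_ring_two_power:
  assumes "n \<ge> 1" "a \<in> carrier (residue_ring (2 ^ n))"
  shows "zero_divisor (residue_ring (2 ^ n)) a \<longleftrightarrow> even a"
proof -
  interpret residues "2 ^ n" "residue_ring (2 ^ n)"
    using residues_two_power[OF assms(1)] by simp_all
  show ?thesis
  proof
    assume "zero_divisor (residue_ring (2 ^ n)) a"
    then obtain b where b: "0 \<le> b" "b < 2 ^ n" "b \<noteq> 0" "2 ^ n dvd a * b"
      by (auto simp: zero_divisor_def res_carrier_eq res_mult_eq res_zero_eq mult.commute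
          mod_eq_0_iff_dvd)
    show "even a"
    proof (rule ccontr)
      assume "odd a"
      then have "2 ^ n dvd b"
        using b(4) by (simp add: coprime_dvd_mult_right_iff)
      then show False
        using b by (simp add: zdvd_not_zless)
    qed
  next
    assume "even a"
    define h :: int where "h = 2 ^ (n - 1)"
    have n: "(2::int) ^ n = 2 * h"
      using assms(1) by (simp add: h_def flip: power_Suc)
    have "h > 0" by (simp add: h_def)
    moreover from this have "h < 2 ^ n"
      by (simp add: n)
    moreover have "(a * h) mod 2 ^ n = 0"
      using \<open>even a\<close> unfolding n by auto
    ultimately show "zero_divisor (residue_ring (2 ^ n)) a"
      unfolding zero_divisor_def using assms
      by (intro conjI bexI[of _ h]) (simp_all add: res_carrier_eq res_mult_eq res_zero_eq)
  qed
qed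

text \<open>Covers cases (i), (ii) and (iii) at once, since each has an even number of odd
  coordinates.\<close>

lemma quat_zero_divisor_two_power:
  assumes "n \<ge> 1"
    and x: "(a1, a2, a3, a4) \<in> carrier (quaternion_ring (residue_ring (2 ^ n)))"
    and ev: "even (a1 + a2 + a3 + a4)"
  shows "zero_divisor (quaternion_ring (residue_ring (2 ^ n))) (a1, a2, a3, a4)"
proof -
  interpret residues "2 ^ n" "residue_ring (2 ^ n)"
    using residues_two_power[OF assms(1)] by simp_all
  define h :: int where "h = 2 ^ (n - 1)"
  have n: "(2::int) ^ n = 2 * h"
    using assms(1) by (simp add: h_def flip: power_Suc)
  have h: "h > 0" by (simp add: h_def)
  have annihil: "(s * h) mod 2 ^ n = 0" if "even s" for s
    using that unfolding n by auto
  have "quat_mult (residue_ring (2 ^ n)) (a1, a2, a3, a4) (h, h, h, h) = (0, 0, 0, 0)"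
    unfolding quat_mult_residue_ring prod.inject
    \<comment> \<open>Factoring out \<open>h\<close> leaves signed sums of the \<open>a\<close>'s;
      signs do not affect parity.\<close>
    unfolding left_diff_distrib[symmetric] distrib_right[symmetric]
    using ev by (intro conjI annihil) auto
  moreover have "h < 2 ^ n"
    using h by (simp add: n)
  ultimately show ?thesis
    using x h unfolding zero_divisor_def
    by (intro conjI bexI[of _ "(h, h, h, h)"])
      (simp_all add: quaternion_ring_simps res_carrier_eq res_zero_eq)
qed

theorem theorem3p1:
  fixes n :: nat and a1 a2 a3 a4 :: int
  assumes "n \<ge> 1"
    and "(a1, a2, a3, a4) \<in> carrier (quaternion_ring (residue_ring (2 ^ n)))"
  shows "
    (\<forall>a\<in>{a1, a2, a3, a4}.
           (a \<in> Units (residue_ring (2 ^ n)) \<longleftrightarrow> odd a) \<and>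
           (zero_divisor (residue_ring (2 ^ n)) a \<longleftrightarrow> even a)) \<and>
    (\<exists>!c. in_case (residue_ring (2 ^ n)) (a1, a2, a3, a4) c) \<and>
    (\<forall>c\<in>{Case_i, Case_ii, Case_iii}.
           in_case (residue_ring (2 ^ n)) (a1, a2, a3, a4) c \<longrightarrow>
           zero_divisor (quaternion_ring (residue_ring (2 ^ n))) (a1, a2, a3, a4)) \<and>
    (\<forall>c\<in>{Case_iv, Case_v}.
           in_case (residue_ring (2 ^ n)) (a1, a2, a3, a4) c \<longrightarrow>
           (a1, a2, a3, a4) \<in> Units (quaternion_ring (residue_ring (2 ^ n))))"
proof -
  let ?R = "residue_ring (2 ^ n)" and ?x = "(a1, a2, a3, a4)"
  interpret residues "2 ^ n" ?R
    using residues_two_power[OF assms(1)] by simp_all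
  have u: "a \<in> Units ?R \<longleftrightarrow> odd a" and z: "zero_divisor ?R a \<longleftrightarrow> even a"
    if "a \<in> {a1, a2, a3, a4}" for a
    using that assms units_residue_ring_two_power zero_divisor_residue_ring_two_power
    by (auto simp: quaternion_ring_simps)
  \<comment> \<open>Each coordinate is odd or even, so the number of odd ones fixes both
    counts.\<close>
  have cases_parity:
    "in_case ?R ?x Case_i \<longleftrightarrow> even a1 \<and> even a2 \<and> even a3 \<and> even a4"
    "in_case ?R ?x Case_ii \<longleftrightarrow> odd a1 \<and> odd a2 \<and> odd a3 \<and> odd a4"
    "in_case ?R ?x Case_iii \<longleftrightarrow> length (filter odd [a1, a2, a3, a4]) = 2"
    "in_case ?R ?x Case_iv \<longleftrightarrow> length (filter odd [a1, a2, a3, a4]) = 3"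
    "in_case ?R ?x Case_v \<longleftrightarrow> length (filter odd [a1, a2, a3, a4]) = 1"
    by (auto simp: num_units_def num_zero_divisors_def u z)
  have "\<exists>!c. in_case ?R ?x c"
  proof (rule ex_ex1I)
    show "\<exists>c. in_case ?R ?x c"
    proof (rule ccontr)
      assume "\<not> ?thesis"
      then have "\<not> in_case ?R ?x c" for c
        by blast
      from this[of Case_i] this[of Case_ii] this[of Case_iii] this[of Case_iv] this[of Case_v]
      show False
        unfolding cases_parity by (auto split: if_splits)
    qed
    show "c = d" if "in_case ?R ?x c" "in_case ?R ?x d" for c d
      \<comment> \<open>Dropping \<open>in_case.simps\<close> keeps \<open>in_case\<close> folded,
        so that \<open>cases_parity\<close> applies.\<close>
      using that by (cases c; cases d) (auto simp: cases_parity simp del: in_case.simps split: if_splits)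
  qed
  moreover have "zero_divisor (quaternion_ring ?R) ?x"
    if "c \<in> {Case_i, Case_ii, Case_iii}" "in_case ?R ?x c" for c
  proof (rule quat_zero_divisor_two_power[OF assms])
    show "even (a1 + a2 + a3 + a4)"
      using that by (auto simp: cases_parity simp del: in_case.simps split: if_splits)
  qed
  moreover have "?x \<in> Units (quaternion_ring ?R)"
    if "c \<in> {Case_iv, Case_v}" "in_case ?R ?x c" for c
  proof (rule quat_unit_if_coprime_norm[OF assms(2)])
    \<comment> \<open>Squaring keeps parity, and one or three coordinates are odd.\<close>
    have "odd (a1\<^sup>2 + a2\<^sup>2 + a3\<^sup>2 + a4\<^sup>2)"
      using that by (auto simp: cases_parity simp del: in_case.simps split: if_splits)
    then show "coprime (a1\<^sup>2 + a2\<^sup>2 + a3\<^sup>2 + a4\<^sup>2) (2 ^ n)"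
      by simp
  qed
  ultimately show ?thesis
    using u z by blast
qed

end
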